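(* Let $m\geq 2$ be an integer with smallest prime divisor $p_1$, and suppose that $\mathrm{ZT}(\mathbb{Z}_m)$ is connected but not a complete graph. Then the maximal degree and the minimal degree of $\mathrm{ZT}(\mathbb{Z}_m)$ are $$\Delta(\mathrm{ZT}(\mathbb{Z}_m))=\deg\left(\frac{m}{p_1}\right)=\frac{m}{p_1}-2\quad\text{and}\quad \delta(\mathrm{ZT}(\mathbb{Z}_m))=\deg(p_1)=p_1-1.$$
   Context: $\mathbb{Z}_m$ is the ring of integers modulo $m$, and $Z(\mathbb{Z}_m)$ is its set of zero-divisors, with $0$ included. The total zero-divisor graph $\mathrm{ZT}(\mathbb{Z}_m)$ is the simple graph whose vertices are the nonzero zero-divisors of $\mathbb{Z}_m$, with distinct vertices $u,v$ adjacent if and only if $uv=0$ and $u+v\in Z(\mathbb{Z}_m)$. Integers are identified with their residue classes in $\mathbb{Z}_m$. A connected graph has at least one vertex; a graph with exactly one vertex is complete. *)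

theory Defs
  imports
    "HOL-Number_Theory.Residues"
    "Graph_Theory.Kuratowski"
begin

definition zero_divisors :: "('a, 'b) ring_scheme \<Rightarrow> 'a set" where
  "zero_divisors R =
     {x \<in> carrier R. \<exists>y \<in> carrier R - {\<zero>\<^bsub>R\<^esub>}. x \<otimes>\<^bsub>R\<^esub> y = \<zero>\<^bsub>R\<^esub>}"

text \<open>
  For a commutative ring, zero is a zero-divisor in this sense exactly if the ring is nontrivial.
\<close>

lemma (in cring) zero_mem_zero_divisors:
  "\<zero> \<in> zero_divisors R \<longleftrightarrow> carrier R \<noteq> {\<zero>}"
  unfolding zero_divisors_def by auto

text \<open>
  As everywhere in the graph library, an undirected simple graph is a symmetric, loop-free
  digraph without parallel arcs: an edge between \<open>u\<close> and \<open>v\<close> is the pair of arcs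
  \<open>(u, v)\<close>, \<open>(v, u)\<close>. The degree of a vertex is therefore its \<^const>\<open>out_degree\<close>.
\<close>

definition total_zero_divisor_graph :: "('a, 'b) ring_scheme \<Rightarrow> ('a, 'a \<times> 'a) pre_digraph"
    (\<open>ZT\<close>) where
  "ZT R = with_proj
     \<lparr> pverts = zero_divisors R - {\<zero>\<^bsub>R\<^esub>},
       parcs = {(u, v). u \<in> zero_divisors R - {\<zero>\<^bsub>R\<^esub>} \<and> v \<in> zero_divisors R - {\<zero>\<^bsub>R\<^esub>} \<and>
                 u \<noteq> v \<and> u \<otimes>\<^bsub>R\<^esub> v = \<zero>\<^bsub>R\<^esub> \<and> u \<oplus>\<^bsub>R\<^esub> v \<in> zero_divisors R} \<rparr>"

lemma (in cring) graph_ZT: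
  assumes "finite (carrier R)"
  shows "graph (ZT R)"
proof -
  let ?Z = "zero_divisors R - {\<zero>}"
  let ?E = "{(u, v). u \<in> ?Z \<and> v \<in> ?Z \<and> u \<noteq> v \<and> u \<otimes> v = \<zero> \<and> u \<oplus> v \<in> zero_divisors R}"
  have fin: "finite ?Z"
    using assms by (auto simp: zero_divisors_def)
  have "?E \<subseteq> ?Z \<times> ?Z" by auto
  with fin have finE: "finite ?E"
    by (meson finite_SigmaI finite_subset)
  have "sym ?E"
    by (rule symI) (auto simp: zero_divisors_def m_comm a_comm)
  then have "pair_graph \<lparr> pverts = ?Z, parcs = ?E \<rparr>"
    using fin finE by unfold_locales (auto simp: symmetric_def)
  then interpret pair_graph "\<lparr> pverts = ?Z, parcs = ?E \<rparr>" .
  show ?thesis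
    unfolding total_zero_divisor_graph_def by (rule graph_axioms)
qed

definition complete_graph :: "('a, 'b) pre_digraph \<Rightarrow> bool" where
  "complete_graph G \<longleftrightarrow> (\<exists>n. K\<^bsub>n\<^esub> G)"

definition max_degree :: "('a, 'b) pre_digraph \<Rightarrow> nat" (\<open>\<Delta>\<close>) where
  "\<Delta> G = Max (out_degree G ` verts G)"

definition min_degree :: "('a, 'b) pre_digraph \<Rightarrow> nat" (\<open>\<delta>\<close>) where
  "\<delta> G = Min (out_degree G ` verts G)"

text \<open>
  \<^const>\<open>residue_ring\<close> has carrier \<open>{0..m - 1}\<close>, so \<open>a mod m\<close> is the residue class of
  an integer \<open>a\<close>. The name \<open>connected\<close> is also a topological notion, hence the qualified
  name below; graph connectedness in the graph library excludes the empty graph.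
\<close>

abbreviation connected_graph :: "('a, 'b) pre_digraph \<Rightarrow> bool" where
  "connected_graph \<equiv> Digraph_Component.connected"

end

theory Submission
  imports Defs
begin

text \<open>
  Fix a prime \<open>q\<close> dividing \<open>m\<close>. For \<open>m = q\<close> there are no vertices, so let \<open>q < m\<close>.
  The neighbours of the vertex \<open>q\<close> lie among the multiples \<open>y\<close> of \<open>m div q\<close>. If \<open>q\<close> divides \<open>m\<close> only once, then \<open>q + y\<close> is a unit for every such
  nonzero \<open>y\<close>: the prime \<open>q\<close> divides the first summand only, and every other prime divisor
  of \<open>m\<close> divides the second summand only. So \<open>q\<close> would be isolated, and a connected graph with
  an isolated vertex is a single point, which is complete. For \<open>m = q\<^sup>2\<close> all nonzero multiples of
  \<open>q\<close> are adjacent, and the graph is complete again. Hence a connected graph that is not complete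
  forces \<open>q\<^sup>2\<close> to be a proper divisor of \<open>m\<close>, for every prime divisor \<open>q\<close>
  (\<open>prime_square_proper_divisor\<close>). Everything else is arithmetic.

  This property makes the sum condition harmless where it matters: \<open>q\<close> divides \<open>m div q\<close>,
  so the sum of a multiple of \<open>q\<close> and a multiple of \<open>m div q\<close> is a multiple of \<open>q\<close>, hence a
  zero-divisor. Therefore \<open>q\<close> is adjacent to all \<open>q - 1\<close> nonzero multiples of \<open>m div q\<close>, and
  \<open>m div q\<close> is adjacent to all nonzero multiples of \<open>q\<close> but itself.

  For the extremality, the neighbours of an arbitrary vertex \<open>x\<close> with \<open>g = gcd x m\<close> are among the
  \<open>g - 1\<close> nonzero multiples of \<open>m div g\<close>. Here \<open>g \<le> m div p\<close> for the smallest prime divisor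
  \<open>p\<close>, and in case of equality \<open>x\<close> is itself one of these multiples, which gives the upper bound.
  For the lower bound choose a prime \<open>q\<close> dividing \<open>g\<close>. All nonzero multiples of \<open>m div q\<close> are
  neighbours of \<open>x\<close>, unless \<open>x\<close> is one of them; but in that case the neighbours of \<open>x\<close>
  include all \<open>m div q - 2 \<ge> q - 1\<close> nonzero multiples of \<open>q\<close> other than \<open>x\<close>.
\<close>

section \<open>Zero-divisors and adjacency modulo \<open>m\<close>\<close>

definition nonzero_multiples :: "int \<Rightarrow> int \<Rightarrow> int set" where
  "nonzero_multiples m d = {y \<in> {0<..<m}. d dvd y}"

lemma finite_nonzero_multiples [simp]: "finite (nonzero_multiples m d)"
  unfolding nonzero_multiples_def by (rule finite_subset[of _ "{0<..<m}"]) auto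

lemma card_nonzero_multiples:
  assumes "d dvd m" "0 < d" "0 < m"
  shows "int (card (nonzero_multiples m d)) = m div d - 1"
proof -
  obtain k where k: "m = d * k" using assms(1) by blast
  have "0 < k" using assms k by (simp add: zero_less_mult_iff)
  have "nonzero_multiples m d = (*) d ` {0<..<k}"
    using assms k by (auto simp: nonzero_multiples_def dvd_def zero_less_mult_iff)
  moreover have "inj_on ((*) d) {0<..<k}" using assms by (auto simp: inj_on_def)
  ultimately have "card (nonzero_multiples m d) = card {0<..<k}" by (simp add: card_image)
  then show ?thesis using k \<open>0 < k\<close> assms by simp
qed

lemma annihilates_iff:
  fixes m x y :: int
  assumes "0 < m"
  shows "m dvd x * y \<longleftrightarrow> m div gcd x m dvd y"
proof -
  let ?g = "gcd x m"
  have g: "0 < ?g" using assms by simp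
  have "m dvd x * y \<longleftrightarrow> ?g * (m div ?g) dvd ?g * (x div ?g * y)"
    by (simp add: mult.assoc[symmetric])
  also have "\<dots> \<longleftrightarrow> m div ?g dvd x div ?g * y" using g by (simp only: dvd_mult_cancel_left) auto
  also have "\<dots> \<longleftrightarrow> m div ?g dvd y"
    using div_gcd_coprime[of x m] assms
    by (intro coprime_dvd_mult_right_iff) (auto simp: coprime_commute)
  finally show ?thesis .
qed

lemma not_coprime_if_annihilates:
  fixes m x y :: int
  assumes "x \<in> {0<..<m}" "m dvd x * y"
  shows "\<not> coprime y m"
  using assms by (metis coprime_commute coprime_dvd_mult_left_iff greaterThanLessThan_iff
      zdvd_not_zless)

lemma residue_ring_ops:
  "\<zero>\<^bsub>residue_ring m\<^esub> = 0"
  "x \<otimes>\<^bsub>residue_ring m\<^esub> y = (x * y) mod m"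
  "x \<oplus>\<^bsub>residue_ring m\<^esub> y = (x + y) mod m"
  by (simp_all add: residue_ring_def)

lemma zero_divisors_residue_ring:
  assumes "m \<ge> 2"
  shows "zero_divisors (residue_ring m) = {x \<in> {0..<m}. \<not> coprime x m}"
proof -
  have "(\<exists>y\<in>{0..m - 1} - {0}. x * y mod m = 0) \<longleftrightarrow> \<not> coprime x m" for x
  proof
    assume "\<exists>y\<in>{0..m - 1} - {0}. x * y mod m = 0"
    then obtain y where "y \<in> {0<..<m}" "m dvd y * x" by (force simp: mult.commute)
    then show "\<not> coprime x m" by (rule not_coprime_if_annihilates)
  next
    assume nc: "\<not> coprime x m"
    let ?g = "gcd x m"
    have "?g \<noteq> 1" "0 < ?g" using nc assms by (simp_all add: coprime_iff_gcd_eq_1)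
    then have "1 < ?g" by linarith
    have "0 < m div ?g" using assms by (simp add: pos_imp_zdiv_pos_iff zdvd_imp_le)
    moreover have "m div ?g < m" using \<open>1 < ?g\<close> assms by (intro int_div_less_self) auto
    moreover have "m dvd x * (m div ?g)" using annihilates_iff[of m x] assms by simp
    ultimately show "\<exists>y\<in>{0..m - 1} - {0}. x * y mod m = 0"
      by (intro bexI[of _ "m div ?g"]) auto
  qed
  then show ?thesis
    unfolding zero_divisors_def residue_ring_def by auto
qed

lemma verts_ZT:
  assumes "m \<ge> 2"
  shows "verts (ZT (residue_ring m)) = {x \<in> {0<..<m}. \<not> coprime x m}"
proof -
  have "verts (ZT (residue_ring m)) = {x \<in> {0..<m}. \<not> coprime x m} - {0}"
    by (simp add: total_zero_divisor_graph_def zero_divisors_residue_ring assms residue_ring_ops)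
  also have "\<dots> = {x \<in> {0<..<m}. \<not> coprime x m}" by auto
  finally show ?thesis .
qed

lemma finite_verts_ZT: "m \<ge> 2 \<Longrightarrow> finite (verts (ZT (residue_ring m)))"
  by (rule finite_subset[of _ "{0<..<m}"]) (auto simp: verts_ZT)

text \<open>
  The neighbours of a vertex \<open>x\<close>, written as a set of multiples (\<open>annihilates_iff\<close>) so that they
  can be counted. A nonzero \<open>y\<close> that annihilates \<open>x\<close> is automatically a zero-divisor.
\<close>

definition neighbours :: "int \<Rightarrow> int \<Rightarrow> int set" where
  "neighbours m x = {y \<in> nonzero_multiples m (m div gcd x m). y \<noteq> x \<and> \<not> coprime (x + y) m}"

lemma finite_neighbours [simp]: "finite (neighbours m x)"
  by (simp add: neighbours_def)

lemma arcs_ZT: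
  assumes "m \<ge> 2"
  shows "arcs (ZT (residue_ring m)) =
    {(x, y). x \<in> verts (ZT (residue_ring m)) \<and> y \<in> neighbours m x}"
proof -
  let ?V = "verts (ZT (residue_ring m))"
  have zd: "u \<in> zero_divisors (residue_ring m) - {0} \<longleftrightarrow> u \<in> ?V" for u
    by (auto simp: total_zero_divisor_graph_def residue_ring_ops)
  have sum: "(x + y) mod m \<in> zero_divisors (residue_ring m) \<longleftrightarrow> \<not> coprime (x + y) m" for x y
    using assms by (simp add: zero_divisors_residue_ring)
  have "arcs (ZT (residue_ring m)) = {(x, y). x \<in> ?V \<and> y \<in> ?V \<and> x \<noteq> y \<and> m dvd x * y \<and>
      \<not> coprime (x + y) m}"
    unfolding zd[symmetric] sum[symmetric]
    by (simp add: total_zero_divisor_graph_def residue_ring_ops dvd_eq_mod_eq_0)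
  also have "\<dots> = {(x, y). x \<in> ?V \<and> y \<in> neighbours m x}"
    using assms not_coprime_if_annihilates[of _ m]
    by (auto simp: verts_ZT neighbours_def nonzero_multiples_def annihilates_iff[symmetric])
  finally show ?thesis .
qed

lemma out_degree_ZT:
  assumes "m \<ge> 2" "x \<in> verts (ZT (residue_ring m))"
  shows "out_degree (ZT (residue_ring m)) x = card (neighbours m x)"
proof -
  have "tail (ZT (residue_ring m)) = fst" by (simp add: total_zero_divisor_graph_def)
  then have "out_arcs (ZT (residue_ring m)) x = Pair x ` neighbours m x"
    using assms by (auto simp: out_arcs_def arcs_ZT)
  then show ?thesis by (simp add: out_degree_def card_image inj_on_def)
qed

lemma complete_graph_ZT_iff:
  assumes "m \<ge> 2"
  shows "complete_graph (ZT (residue_ring m)) \<longleftrightarrow>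
    (\<forall>x\<in>verts (ZT (residue_ring m)). \<forall>y\<in>verts (ZT (residue_ring m)).
      x \<noteq> y \<longrightarrow> y \<in> neighbours m x)"
proof -
  define P where "P = \<lparr> pverts = verts (ZT (residue_ring m)), parcs = arcs (ZT (residue_ring m)) \<rparr>"
  have Z: "ZT (residue_ring m) = with_proj P"
    by (simp add: P_def total_zero_divisor_graph_def)
  have "y \<in> verts (ZT (residue_ring m)) \<and> y \<noteq> x"
    if "x \<in> verts (ZT (residue_ring m))" "y \<in> neighbours m x" for x y
  proof -
    from that have "m dvd x * y" "x \<in> {0<..<m}" "y \<in> {0<..<m}" "y \<noteq> x"
      using assms by (auto simp: neighbours_def nonzero_multiples_def annihilates_iff verts_ZT)
    moreover from this have "\<not> coprime y m"
      by (intro not_coprime_if_annihilates[of x])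
    ultimately show ?thesis using assms by (simp add: verts_ZT)
  qed
  moreover have "complete_graph (with_proj P) \<longleftrightarrow>
      parcs P = {(u,v). (u,v) \<in> pverts P \<times> pverts P \<and> u \<noteq> v}"
    using finite_verts_ZT[OF assms] by (simp add: complete_graph_def complete_digraph_pair_def P_def)
  ultimately show ?thesis
    unfolding Z[symmetric] using arcs_ZT[OF assms] by (simp add: P_def set_eq_iff) blast
qed

section \<open>Connectedness\<close>

lemma connected_isolated_vertex:
  assumes "connected_graph G" "x \<in> verts G"
    and iso: "\<And>e. e \<in> arcs G \<Longrightarrow> tail G e \<noteq> x \<and> head G e \<noteq> x"
  shows "verts G = {x}"
proof -
  have "v = x" if v: "v \<in> verts G" for v
  proof -
    have "x \<rightarrow>\<^sup>*\<^bsub>mk_symmetric G\<^esub> v"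
      using assms(1,2) v
      by (auto simp: Digraph_Component.connected_def strongly_connected_def mk_symmetric_def)
    then have "(x, v) \<in> (parcs (mk_symmetric G))\<^sup>*"
      by (auto dest: reachable_rtranclI)
    then show "v = x"
      by (induction rule: rtrancl_induct) (use iso in \<open>auto simp: mk_symmetric_def\<close>)
  qed
  then show ?thesis using assms(2) by blast
qed

text \<open>
  The hypotheses on the graph are converted into arithmetic by three exclusions: \<open>m = q\<close> gives
  the empty graph, which is not connected; \<open>q\<close> dividing \<open>m\<close> exactly once makes \<open>q\<close> isolated;
  and \<open>m = q\<^sup>2\<close> gives a complete graph.
\<close>

lemma prime_square_proper_divisor:
  fixes m q :: int
  assumes "m \<ge> 2" "connected_graph (ZT (residue_ring m))"
    and not_complete: "\<not> complete_graph (ZT (residue_ring m))"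
    and q: "prime q" "q dvd m"
  shows "q dvd m div q" "q < m div q"
proof -
  let ?G = "ZT (residue_ring m)"
  obtain k where k: "m = q * k" using q by blast
  have "1 < q" using q prime_gt_1_int by auto
  have "0 < k" using k assms(1) \<open>1 < q\<close> by (smt (verit) zero_less_mult_iff)
  have "k \<noteq> 1"
  proof
    assume "k = 1"
    then have "verts ?G = {}"
      using q k assms(1)
      by (auto simp: verts_ZT) (meson coprime_commute prime_imp_coprime zdvd_not_zless)
    then show False
      using assms(2)
      by (simp add: Digraph_Component.connected_def strongly_connected_def mk_symmetric_def)
  qed
  then have qm: "q < m" using k \<open>1 < q\<close> \<open>0 < k\<close> by simp
  then have qv: "q \<in> verts ?G"
    using assms(1) q \<open>1 < q\<close> by (auto simp: verts_ZT coprime_absorb_left)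
  have "q dvd k"
  proof (rule ccontr)
    assume nd: "\<not> q dvd k"
    \<comment> \<open>The primes dividing \<open>q + y\<close> are neither \<open>q\<close>, as \<open>y\<close> is not a multiple of \<open>q * k = m\<close>,
      nor divisors of \<open>k\<close>, as \<open>q\<close> is coprime to \<open>k\<close>.\<close>
    have "neighbours m q = {}"
    proof -
      have False if "y \<in> neighbours m q" for y
      proof -
        from that have y: "0 < y" "y < m" "k dvd y" "\<not> coprime (q + y) m"
          using k q \<open>1 < q\<close> by (auto simp: neighbours_def nonzero_multiples_def)
        have "\<not> q dvd y"
          using y nd k q by (metis coprime_commute divides_mult prime_imp_coprime zdvd_not_zless)
        then have "coprime (q + y) q"
          using q by (simp add: coprime_commute prime_imp_coprime dvd_add_right_iff)
        moreover have "coprime (q + y) k"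
        proof -
          obtain j where "y = k * j" using y by blast
          then show ?thesis using nd q
            by (metis coprime_iff_gcd_eq_1 gcd_add_mult mult.commute add.commute gcd.commute
                prime_imp_coprime)
        qed
        ultimately show False using y k by simp
      qed
      then show ?thesis by blast
    qed
    moreover have sym: "x \<in> neighbours m y" if "x \<in> verts ?G" "y \<in> neighbours m x" for x y
      using that assms(1)
      by (auto simp: neighbours_def nonzero_multiples_def annihilates_iff[symmetric] verts_ZT
          mult.commute add.commute)
    ultimately have no_arc: "u \<noteq> q \<and> v \<noteq> q" if "(u, v) \<in> arcs ?G" for u v
      using that sym[of u v] by (auto simp: arcs_ZT[OF assms(1)])
    have "verts ?G = {q}"
    proof (rule connected_isolated_vertex[OF assms(2) qv])
      fix e assume "e \<in> arcs ?G"
      then show "tail ?G e \<noteq> q \<and> head ?G e \<noteq> q"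
        using no_arc[of "fst e" "snd e"] by (simp add: total_zero_divisor_graph_def)
    qed
    then show False using not_complete assms(1) by (simp add: complete_graph_ZT_iff)
  qed
  moreover have "k \<noteq> q"
  proof
    assume "k = q"
    have d: "q dvd x" if "\<not> coprime x m" for x
      using that q k \<open>k = q\<close> by (metis coprime_commute coprime_mult_left_iff prime_imp_coprime)
    have "m dvd x * y \<and> \<not> coprime (x + y) m" if "q dvd x" "q dvd y" for x y
      using that k \<open>k = q\<close> q by (metis coprime_common_divisor dvd_add mult_dvd_mono not_prime_unit)
    then have "complete_graph ?G"
      using assms(1) d
      by (simp add: complete_graph_ZT_iff verts_ZT neighbours_def nonzero_multiples_def
          annihilates_iff[symmetric])
    then show False using not_complete by contradiction
  qed
  ultimately show "q dvd m div q" "q < m div q"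
    using k \<open>0 < k\<close> \<open>1 < q\<close> zdvd_imp_le[of q k] by auto
qed

section \<open>Degrees\<close>

lemma card_neighbours_prime:
  fixes m q :: int
  assumes "0 < m" "prime q" "q dvd m" "q dvd m div q" "q < m div q"
  shows "int (card (neighbours m q)) = q - 1"
proof -
  have "\<not> coprime (q + y) m" if "m div q dvd y" for y
    using that assms by (meson coprime_common_divisor dvd_add dvd_refl dvd_trans not_prime_unit)
  moreover have "\<not> m div q dvd q"
    using assms prime_gt_0_int[of q] zdvd_not_zless by blast
  moreover have "gcd q m = q" using assms prime_gt_0_int[of q] by (simp add: gcd_proj1_iff)
  ultimately have "neighbours m q = nonzero_multiples m (m div q)"
    by (auto simp: neighbours_def nonzero_multiples_def)
  then show ?thesis
    using card_nonzero_multiples[of "m div q" m] assms prime_gt_0_int[of q] by auto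
qed

text \<open>
  A multiple \<open>x\<close> of \<open>m div q\<close> annihilates every multiple of \<open>q\<close>, itself included; it is removed
  on the left because the graph has no loops.
\<close>

lemma neighbours_cofactor_multiple:
  fixes m q :: int
  assumes "0 < m" "prime q" "q dvd m" "q dvd m div q" "m div q dvd x"
  shows "nonzero_multiples m q - {x} \<subseteq> neighbours m x"
proof
  fix y assume y: "y \<in> nonzero_multiples m q - {x}"
  then have "q dvd y" by (simp add: nonzero_multiples_def)
  then have "m dvd x * y"
    using assms mult_dvd_mono[of "m div q" x q y] by simp
  moreover have "\<not> coprime (x + y) m"
    using \<open>q dvd y\<close> assms by (meson coprime_common_divisor dvd_add dvd_trans not_prime_unit)
  ultimately show "y \<in> neighbours m x"
    using y assms(1) by (simp add: neighbours_def nonzero_multiples_def annihilates_iff)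
qed

lemma card_nonzero_multiples_minus:
  fixes m q :: int
  assumes "0 < m" "prime q" "q dvd m" "x \<in> nonzero_multiples m q"
  shows "int (card (nonzero_multiples m q - {x})) = m div q - 2"
proof -
  have "int (card (nonzero_multiples m q)) = m div q - 1"
    using assms prime_gt_0_int[of q] by (intro card_nonzero_multiples) auto
  moreover have "card (nonzero_multiples m q) > 0" using assms(4) by (auto simp: card_gt_0_iff)
  ultimately show ?thesis using assms(4) by simp
qed

text \<open>
  If \<open>g = gcd x m\<close> is strictly below \<open>m div p\<close>, then counting the \<open>g - 1\<close> annihilators of \<open>x\<close>
  suffices. Otherwise \<open>g = m div p\<close>, the annihilators are the multiples of \<open>p\<close>, and \<open>x\<close> is one
  of them since \<open>p\<close> divides \<open>g\<close>.
\<close>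

lemma card_neighbours_upper:
  fixes m p x :: int
  assumes "0 < m" "prime p" "p dvd m" "p dvd m div p"
    and smallest: "\<And>q. prime q \<Longrightarrow> q dvd m \<Longrightarrow> p \<le> q"
    and x: "x \<in> {0<..<m}"
  shows "int (card (neighbours m x)) \<le> m div p - 2"
proof -
  let ?g = "gcd x m"
  have g: "0 < ?g" "?g dvd m" "m = ?g * (m div ?g)" using assms(1) by auto
  have "0 < x" "x < m" using x by auto
  then have "?g < m" using zdvd_imp_le[of ?g x] by (metis gcd_dvd1 order_le_less_trans)
  then have "m div ?g \<noteq> 1" using g(3) by (metis mult.right_neutral order_less_irrefl)
  have "0 < m div ?g" using g assms(1) by (simp add: pos_imp_zdiv_pos_iff zdvd_imp_le)
  obtain q where q: "prime q" "q dvd m div ?g"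
    using prime_divisor_exists[of "m div ?g"] \<open>m div ?g \<noteq> 1\<close> \<open>0 < m div ?g\<close> by auto
  have "q dvd m" using q g by (metis dvd_mult)
  then have "p \<le> m div ?g"
    using smallest[OF q(1)] zdvd_imp_le[OF q(2) \<open>0 < m div ?g\<close>] by linarith
  have card_g: "int (card (nonzero_multiples m (m div ?g))) = ?g - 1"
  proof -
    have "m div (m div ?g) = ?g" using g \<open>0 < m div ?g\<close>
      by (metis nonzero_mult_div_cancel_right order_less_irrefl)
    then show ?thesis
      using card_nonzero_multiples[of "m div ?g" m] g \<open>0 < m div ?g\<close> assms(1)
      by (metis dvd_triv_right)
  qed
  have "m = p * (m div p)" "0 < p" using assms prime_gt_0_int by auto
  then have le: "?g \<le> m div p"
    using mult_left_mono[OF \<open>p \<le> m div ?g\<close>, of ?g] g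
    by (metis mult.commute mult_le_cancel_left_pos order_less_imp_le)
  have sub: "neighbours m x \<subseteq> nonzero_multiples m (m div ?g) - {x}"
    by (auto simp: neighbours_def)
  show ?thesis
  proof (cases "?g = m div p")
    case True
    then have "p dvd x" using assms(4) by (metis dvd_trans gcd_dvd1)
    moreover have "m div ?g = p"
      using True \<open>m = p * (m div p)\<close> g(1) by (metis nonzero_mult_div_cancel_right order_less_irrefl)
    ultimately have "neighbours m x \<subseteq> nonzero_multiples m p - {x}" "x \<in> nonzero_multiples m p"
      using sub x by (simp_all add: nonzero_multiples_def)
    then have "int (card (neighbours m x)) \<le> int (card (nonzero_multiples m p - {x}))"
      by (simp add: card_mono del: card_Diff_insert)
    also have "\<dots> = m div p - 2"
      by (rule card_nonzero_multiples_minus) fact+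
    finally show ?thesis .
  next
    case False
    have "card (neighbours m x) \<le> card (nonzero_multiples m (m div ?g))"
      using sub by (intro card_mono) auto
    then show ?thesis using card_g False le by linarith
  qed
qed

text \<open>
  If \<open>x\<close> is not a multiple of \<open>m div q\<close>, it is adjacent to all \<open>q - 1\<close> nonzero ones. Multiples
  of \<open>m div q\<close> are handled separately, because \<open>x\<close> is then missing from its own
  neighbourhood; such an \<open>x\<close> has at least \<open>m div q - 2\<close> neighbours.
\<close>

lemma card_neighbours_lower:
  fixes m q x :: int
  assumes "0 < m" "prime q" "q dvd m" "q dvd m div q" "q < m div q"
    and x: "x \<in> {0<..<m}" "q dvd x"
  shows "q - 1 \<le> int (card (neighbours m x))"
proof (cases "m div q dvd x")
  case True
  have "x \<in> nonzero_multiples m q" using x by (simp add: nonzero_multiples_def)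
  then have "m div q - 2 = int (card (nonzero_multiples m q - {x}))"
    using card_nonzero_multiples_minus[OF assms(1-3)] by simp
  also have "\<dots> \<le> int (card (neighbours m x))"
    using neighbours_cofactor_multiple[OF assms(1-4) True] by (simp add: card_mono)
  finally show ?thesis using assms(5) by linarith
next
  case False
  have "nonzero_multiples m (m div q) \<subseteq> neighbours m x"
  proof
    fix y assume y: "y \<in> nonzero_multiples m (m div q)"
    then have d: "m div q dvd y" by (simp add: nonzero_multiples_def)
    then have "m dvd x * y" using mult_dvd_mono[OF x(2) d] assms(3) by simp
    moreover have "\<not> coprime (x + y) m"
      using d x(2) assms by (meson coprime_common_divisor dvd_add dvd_trans not_prime_unit)
    ultimately show "y \<in> neighbours m x"
      using y d False assms(1) by (auto simp: neighbours_def nonzero_multiples_def annihilates_iff)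
  qed
  then have "card (nonzero_multiples m (m div q)) \<le> card (neighbours m x)" by (simp add: card_mono)
  moreover have "int (card (nonzero_multiples m (m div q))) = q - 1"
    using card_nonzero_multiples[of "m div q" m] assms prime_gt_0_int[of q] by auto
  ultimately show ?thesis by linarith
qed

section \<open>The extremal degrees\<close>

theorem lemma4p4:
  fixes m p\<^sub>1 :: int
  assumes "m \<ge> 2"
    and "p\<^sub>1 = Min (prime_factors m)"
    and "connected_graph (ZT (residue_ring m))"
    and "\<not> complete_graph (ZT (residue_ring m))"
  shows "\<Delta> (ZT (residue_ring m)) = out_degree (ZT (residue_ring m)) ((m div p\<^sub>1) mod m) \<and>
         int (out_degree (ZT (residue_ring m)) ((m div p\<^sub>1) mod m)) = m div p\<^sub>1 - 2 \<and>
         \<delta> (ZT (residue_ring m)) = out_degree (ZT (residue_ring m)) (p\<^sub>1 mod m) \<and>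
         int (out_degree (ZT (residue_ring m)) (p\<^sub>1 mod m)) = p\<^sub>1 - 1"
proof -
  let ?G = "ZT (residue_ring m)" and ?c = "m div p\<^sub>1"
  have "0 < m" using assms(1) by simp
  have "prime_factors m \<noteq> {}"
    using assms(1) prime_divisor_exists[of m] by (auto simp: prime_factors_dvd)
  then have "p\<^sub>1 \<in> prime_factors m" unfolding assms(2) by (intro Min_in) auto
  then have p: "prime p\<^sub>1" "p\<^sub>1 dvd m" by auto
  have smallest: "p\<^sub>1 \<le> q" if "prime q" "q dvd m" for q
    unfolding assms(2) using that assms(1) by (intro Min_le) (auto simp: prime_factors_dvd)
  note sq = prime_square_proper_divisor[OF assms(1,3,4)]
  have p1: "1 < p\<^sub>1" using p prime_gt_1_int by auto
  have c: "?c < m" "p\<^sub>1 < ?c" using sq[OF p] p1 assms(1) by (auto intro: int_div_less_self)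
  have nc: "\<not> coprime x m" if "p\<^sub>1 dvd x" for x
    using that p by (meson coprime_common_divisor not_prime_unit)
  have verts: "p\<^sub>1 \<in> verts ?G" "?c \<in> verts ?G"
    using c p1 assms(1) nc sq[OF p] by (auto simp: verts_ZT)
  have mods: "p\<^sub>1 mod m = p\<^sub>1" "?c mod m = ?c" using c p1 by auto
  have upper: "int (out_degree ?G x) \<le> ?c - 2" if "x \<in> verts ?G" for x
    using card_neighbours_upper[OF \<open>0 < m\<close> p sq(1)[OF p] smallest] that
    by (simp add: out_degree_ZT[OF assms(1) that] verts_ZT[OF assms(1)])
  have deg_p: "int (out_degree ?G p\<^sub>1) = p\<^sub>1 - 1"
    using card_neighbours_prime[OF \<open>0 < m\<close> p sq[OF p]] verts by (simp add: out_degree_ZT assms(1))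
  have deg_c: "int (out_degree ?G ?c) = ?c - 2"
  proof (rule antisym)
    have "?c \<in> nonzero_multiples m p\<^sub>1" using c p1 sq[OF p] by (simp add: nonzero_multiples_def)
    then have "?c - 2 = int (card (nonzero_multiples m p\<^sub>1 - {?c}))"
      using card_nonzero_multiples_minus[OF \<open>0 < m\<close> p] by simp
    also have "\<dots> \<le> int (card (neighbours m ?c))"
      using neighbours_cofactor_multiple[OF \<open>0 < m\<close> p sq(1)[OF p] dvd_refl] by (simp add: card_mono)
    finally show "?c - 2 \<le> int (out_degree ?G ?c)" using verts by (simp add: out_degree_ZT assms(1))
  qed (use upper verts in blast)
  have lower: "p\<^sub>1 - 1 \<le> int (out_degree ?G x)" if xv: "x \<in> verts ?G" for x
  proof -
    have x: "x \<in> {0<..<m}" "\<not> coprime x m" using xv assms(1) by (auto simp: verts_ZT)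
    then obtain q where "prime q" "q dvd gcd x m"
      using prime_divisor_exists[of "gcd x m"] by (auto simp: coprime_iff_gcd_eq_1)
    then have q: "prime q" "q dvd x" "q dvd m" by auto
    have "q - 1 \<le> int (card (neighbours m x))"
      using card_neighbours_lower[OF \<open>0 < m\<close> q(1,3) sq[OF q(1,3)] x(1) q(2)] .
    then show ?thesis using smallest[OF q(1,3)] out_degree_ZT[OF assms(1) xv] by linarith
  qed
  have "\<Delta> ?G = out_degree ?G ?c"
    unfolding max_degree_def using finite_verts_ZT[OF assms(1)] verts upper deg_c
    by (intro Max_eqI) fastforce+
  moreover have "\<delta> ?G = out_degree ?G p\<^sub>1"
    unfolding min_degree_def using finite_verts_ZT[OF assms(1)] verts lower deg_p
    by (intro Min_eqI) fastforce+
  ultimately show ?thesis using deg_p deg_c mods by simp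
qed

end
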